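(* Let $V$ be an infinite-dimensional Banach space and let $E$ be a standard Banach sequence space. Then the set \[ \mathcal{I}=\{T\colon V\to E : T \text{ is linear, continuous and injective}\} \] is either empty or $(1,\mathfrak{c})$-spaceable in $\mathcal{L}(V;E)$.
   Context: All vector spaces are over a fixed scalar field $\mathbb{K}$, which is either $\mathbb{R}$ or $\mathbb{C}$. For Banach spaces $V,E$, $\mathcal{L}(V;E)$ is the Banach space of all continuous linear operators $V\to E$ with the operator norm. $\mathfrak{c}$ is the cardinality of $\mathbb{R}$. Dimension means algebraic (Hamel) dimension. $(\alpha,\beta)$-spaceability: let $\alpha,\beta,\lambda$ be cardinal numbers and $Z$ a topological vector space with $\dim Z=\lambda$ and $\alpha<\beta\le\lambda$. A subset $A\subset Z$ is $\alpha$-lineable if $A\cup\{0\}$ contains an $\alpha$-dimensional linear subspace of $Z$. A set $A\subset Z$ is $(\alpha,\beta)$-spaceable if it is $\alpha$-lineable and for every subspace $W_\alpha\subset Z$ with $W_\alpha\subset A\cup\{0\}$ and $\dim W_\alpha=\alpha$ there is a closed subspace $W_\beta\subset Z$ with $\dim W_\beta=\beta$ and $W_\alpha\subset W_\beta\subset A\cup\{0\}$. Standard Banach sequence space: let $X\neq\{0\}$ be a Banach space over $\mathbb{K}$. A standard Banach sequence space over $X$ is an infinite-dimensional Banach space $E$ whose elements are $X$-valued sequences $x=(x_j)_{j=1}^\infty$ (with coordinatewise linear operations) such that: (i) there is $C>0$ such that $\|x_j\|_X\le C\|x\|_E$ for every $x=(x_j)_{j=1}^\infty\in E$ and all $j\in\mathbb{N}$;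 (ii) if $x=(x_j)_{j=1}^\infty\in E$ and $(x_{n_k})_{k=1}^\infty$ is a subsequence of $x$, then $(x_{n_k})_{k=1}^\infty\in E$ and $\|(x_{n_k})_{k=1}^\infty\|_E\le\|x\|_E$; (iii) if $(x_j)_{j=1}^\infty\in E$ and $\{n_1<n_2<n_3<\cdots\}$ is an infinite subset of $\mathbb{N}$, then the sequence $(y_j)_{j=1}^\infty$ defined by $y_j=x_i$ if $j=n_i$, and $y_j=0$ otherwise, belongs to $E$ and $\|(y_j)_{j=1}^\infty\|_E\le\|(x_j)_{j=1}^\infty\|_E$. A standard Banach sequence space is a standard Banach sequence space over some Banach space $X\ne\{0\}$. *)

theory Defs
  imports "HOL-Analysis.Analysis" "HOL-Library.Function_Algebras"
begin

unbundle cardinal_syntax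

section \<open>The scalar field\<close>

text \<open>The scalar field is \<open>\<real>\<close> or \<open>\<complex>\<close>, up to isometric field isomorphism; both types are instances.\<close>

class real_or_complex = real_normed_field +
  assumes real_or_complex:
    "(\<exists>f :: 'a \<Rightarrow> real. bij f \<and> (\<forall>x y. f (x + y) = f x + f y \<and> f (x * y) = f x * f y)
        \<and> (\<forall>x. norm (f x) = norm x)) \<or>
     (\<exists>f :: 'a \<Rightarrow> complex. bij f \<and> (\<forall>x y. f (x + y) = f x + f y \<and> f (x * y) = f x * f y)
        \<and> (\<forall>x. norm (f x) = norm x))"

instance real :: real_or_complex
  by standard (rule disjI1, rule exI[of _ id], simp)

instance complex :: real_or_complex
  by standard (rule disjI2, rule exI[of _ id], simp)

section \<open>Banach spaces over the scalar field\<close>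

text \<open>
  The class \<open>banach\<close> only provides real scalars. A Banach space over \<open>'k\<close> is a type of that class
  together with a \<open>'k\<close>-vector space structure which extends the real one and for which the norm is
  homogeneous.
\<close>

locale banach_space_over = vector_space s
  for s :: "'k::real_or_complex \<Rightarrow> 'v::banach \<Rightarrow> 'v" +
  assumes scale_of_real: "s (of_real r) x = r *\<^sub>R x"
    and norm_scale: "norm (s c x) = norm c * norm x"

text \<open>The value outside \<open>S\<close> is a dummy; \<open>Metric_space\<close> demands a distance that is total,
  nonnegative and symmetric.\<close>

definition norm_dist :: "'a::ab_group_add set \<Rightarrow> ('a \<Rightarrow> real) \<Rightarrow> 'a \<Rightarrow> 'a \<Rightarrow> real" where
  "norm_dist S N x y = (if x \<in> S \<and> y \<in> S then N (x - y) else 0)"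

definition norm_topology :: "'a::ab_group_add set \<Rightarrow> ('a \<Rightarrow> real) \<Rightarrow> 'a topology" where
  "norm_topology S N = Metric_space.mtopology S (norm_dist S N)"

text \<open>A Banach space whose underlying set is a linear subspace \<open>S\<close> of an ambient vector space;
  the norm \<open>N\<close> is unconstrained outside \<open>S\<close>.\<close>

locale banach_space_on = vector_space s
  for s :: "'k::real_or_complex \<Rightarrow> 'a::ab_group_add \<Rightarrow> 'a"
    and S :: "'a set" and N :: "'a \<Rightarrow> real" +
  assumes subspace_carrier: "subspace S"
    and N_eq_zero: "x \<in> S \<Longrightarrow> N x = 0 \<longleftrightarrow> x = 0"
    and N_scale: "x \<in> S \<Longrightarrow> N (s c x) = norm c * N x"
    and N_triangle: "x \<in> S \<Longrightarrow> y \<in> S \<Longrightarrow> N (x + y) \<le> N x + N y"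
    and complete: "Metric_space.mcomplete S (norm_dist S N)"

lemma (in banach_space_on) metric: "Metric_space S (norm_dist S N)"
proof -
  have neg: "N (- x) = N x" if "x \<in> S" for x
    using N_scale[OF that, of "- 1"] by simp
  have nonneg: "0 \<le> N x" if "x \<in> S" for x
    using N_triangle[OF that subspace_neg[OF subspace_carrier that]]
      N_eq_zero[OF subspace_0[OF subspace_carrier]] neg[OF that] by simp
  have diff: "x - y \<in> S" if "x \<in> S" "y \<in> S" for x y
    using subspace_diff[OF subspace_carrier that] .
  show ?thesis
  proof
    show "0 \<le> norm_dist S N x y" for x y
      by (simp add: norm_dist_def nonneg diff)
    show "norm_dist S N x y = norm_dist S N y x" for x y
      using neg[OF diff, of x y] by (simp add: norm_dist_def)
    show "norm_dist S N x y = 0 \<longleftrightarrow> x = y" if "x \<in> S" "y \<in> S" for x y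
      using that by (simp add: norm_dist_def N_eq_zero diff)
    show "norm_dist S N x z \<le> norm_dist S N x y + norm_dist S N y z"
      if "x \<in> S" "y \<in> S" "z \<in> S" for x y z
      using that N_triangle[OF diff diff, of x y y z] by (simp add: norm_dist_def)
  qed
qed

section \<open>Algebraic dimension and spaceability\<close>

definition has_dim :: "('k::field \<Rightarrow> 'a::ab_group_add \<Rightarrow> 'a) \<Rightarrow> 'a set \<Rightarrow> 'c rel \<Rightarrow> bool" where
  "has_dim s W \<alpha> \<longleftrightarrow>
     (\<exists>B. \<not> module.dependent s B \<and> module.span s B = W \<and> |B| =o \<alpha>)"

definition infinite_dimensional :: "('k::field \<Rightarrow> 'a::ab_group_add \<Rightarrow> 'a) \<Rightarrow> 'a set \<Rightarrow> bool" where
  "infinite_dimensional s W \<longleftrightarrow> \<not> (\<exists>B. finite B \<and> module.span s B = W)"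

text \<open>The ambient topological vector space is \<open>topspace Z\<close>, a linear subspace of the type \<open>'a\<close>;
  \<open>has_dim s W \<alpha>\<close> forces \<open>W\<close> to be a linear subspace.\<close>

definition lineable ::
  "('k::field \<Rightarrow> 'a::ab_group_add \<Rightarrow> 'a) \<Rightarrow> 'a topology \<Rightarrow> 'c rel \<Rightarrow> 'a set \<Rightarrow> bool" where
  "lineable s Z \<alpha> A \<longleftrightarrow>
     A \<subseteq> topspace Z \<and> (\<exists>W. W \<subseteq> A \<union> {0} \<and> has_dim s W \<alpha>)"

definition spaceable ::
  "('k::field \<Rightarrow> 'a::ab_group_add \<Rightarrow> 'a) \<Rightarrow> 'a topology \<Rightarrow> 'c rel \<Rightarrow> 'd rel \<Rightarrow> 'a set \<Rightarrow> bool" where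
  "spaceable s Z \<alpha> \<beta> A \<longleftrightarrow>
     \<alpha> <o \<beta> \<and> (\<exists>\<kappa> :: 'a rel. has_dim s (topspace Z) \<kappa> \<and> \<beta> \<le>o \<kappa>) \<and>
     lineable s Z \<alpha> A \<and>
     (\<forall>W. W \<subseteq> A \<union> {0} \<and> has_dim s W \<alpha> \<longrightarrow>
        (\<exists>W'. closedin Z W' \<and> has_dim s W' \<beta> \<and> W \<subseteq> W' \<and> W' \<subseteq> A \<union> {0}))"

section \<open>Standard Banach sequence spaces\<close>

definition fun_scale :: "('k \<Rightarrow> 'a \<Rightarrow> 'a) \<Rightarrow> 'k \<Rightarrow> ('i \<Rightarrow> 'a) \<Rightarrow> 'i \<Rightarrow> 'a" where
  "fun_scale s c f = (\<lambda>i. s c (f i))"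

lemma vector_space_fun_scale:
  assumes "vector_space s"
  shows "vector_space (fun_scale s)"
proof -
  interpret vector_space s by fact
  show ?thesis
    by standard (auto simp: fun_scale_def fun_eq_iff scale_right_distrib scale_left_distrib)
qed

locale standard_banach_sequence_space =
  X: banach_space_over scaleX + banach_space_on "fun_scale scaleX" E N
  for scaleX :: "'k::real_or_complex \<Rightarrow> 'x::banach \<Rightarrow> 'x"
    and E :: "(nat \<Rightarrow> 'x) set" and N :: "(nat \<Rightarrow> 'x) \<Rightarrow> real" +
  assumes X_nonzero: "\<exists>a :: 'x. a \<noteq> 0"
    and infinite_dim: "infinite_dimensional (fun_scale scaleX) E"
    and coordinate_bound: "\<exists>C>0. \<forall>x\<in>E. \<forall>j. norm (x j) \<le> C * N x"
    and subsequence: "x \<in> E \<Longrightarrow> strict_mono n \<Longrightarrow> (\<lambda>k. x (n k)) \<in> E \<and> N (\<lambda>k. x (n k)) \<le> N x"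
    and spread: "x \<in> E \<Longrightarrow> strict_mono n \<Longrightarrow>
      (\<lambda>j. if j \<in> range n then x (inv n j) else 0) \<in> E \<and>
      N (\<lambda>j. if j \<in> range n then x (inv n j) else 0) \<le> N x"

section \<open>Spaces of operators\<close>

definition continuous_operators ::
  "('k::field \<Rightarrow> 'v::real_normed_vector \<Rightarrow> 'v) \<Rightarrow> ('k \<Rightarrow> 'a::ab_group_add \<Rightarrow> 'a) \<Rightarrow>
   'a set \<Rightarrow> ('a \<Rightarrow> real) \<Rightarrow> ('v \<Rightarrow> 'a) set" where
  "continuous_operators scaleV s S N =
     {T. range T \<subseteq> S \<and> Vector_Spaces.linear scaleV s T \<and>
         continuous_map euclidean (norm_topology S N) T}"

definition operator_norm :: "('a \<Rightarrow> real) \<Rightarrow> ('v::real_normed_vector \<Rightarrow> 'a) \<Rightarrow> real" where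
  "operator_norm N T = (SUP x\<in>cball 0 1. N (T x))"

definition operator_topology ::
  "('k::field \<Rightarrow> 'v::real_normed_vector \<Rightarrow> 'v) \<Rightarrow> ('k \<Rightarrow> 'a::ab_group_add \<Rightarrow> 'a) \<Rightarrow>
   'a set \<Rightarrow> ('a \<Rightarrow> real) \<Rightarrow> ('v \<Rightarrow> 'a) topology" where
  "operator_topology scaleV s S N =
     norm_topology (continuous_operators scaleV s S N) (operator_norm N)"

end

theory Submission
  imports Defs
begin

text \<open>
  A one-dimensional subspace inside \<open>I \<union> {0}\<close> is the span of some \<open>T\<close> in \<open>I\<close>; fix it. The
  indices \<open>\<ge> 1\<close> split into infinitely many infinite sets \<open>range (position i)\<close>, and
  \<open>k < position i k\<close>. Let \<open>S\<^sub>i\<close> write a sequence \<open>y\<close> onto the \<open>i\<close>-th set and \<open>0\<close> elsewhere; it is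
  a contraction of \<open>E\<close>. The subspace that contains \<open>T\<close> is the set of all bounded operators of the
  form \<open>a\<^sub>0 T + \<Sum>i. a\<^sub>i\<^sub>+\<^sub>1 S\<^sub>i T\<close>, where the series is only required to converge coordinatewise;
  \<open>mix a\<close> is the formal operator \<open>a\<^sub>0 + \<Sum>i. a\<^sub>i\<^sub>+\<^sub>1 S\<^sub>i\<close>.

  \<^emph>\<open>Injectivity\<close> (\<open>mix_eq_0\<close>). Suppose that \<open>mix a y = 0\<close>. If \<open>a\<^sub>0 = 0\<close> and \<open>a\<^sub>i\<^sub>+\<^sub>1 \<noteq> 0\<close>, then
  the coordinates in the \<open>i\<close>-th set show \<open>y = 0\<close>. If \<open>a\<^sub>0 \<noteq> 0\<close>, then \<open>y 0 = 0\<close>, and \<open>y (position i k)\<close>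
  is a multiple of \<open>y k\<close>; as \<open>k < position i k\<close>, induction gives \<open>y = 0\<close>.

  \<^emph>\<open>Closedness\<close> (\<open>convergent_coeffs\<close>, \<open>closedin_mixes\<close>). Coordinates depend continuously on the
  operator. A single nonzero vector \<open>y = T v\<close> recovers the coefficients: if \<open>m\<close> is the first index
  with \<open>y m \<noteq> 0\<close>, then coordinate \<open>m\<close> of \<open>mix a y\<close> is \<open>a\<^sub>0 y m\<close>, and coordinate
  \<open>position i m\<close> then determines \<open>a\<^sub>i\<^sub>+\<^sub>1\<close>. Hence convergence of operators forces convergence of
  each coefficient, and the limit has the same form.

  \<^emph>\<open>Dimension\<close> (\<open>has_dim_mixes\<close>). There are only continuum many coefficient sequences. On the other
  hand, the sequences \<open>a\<^sub>i\<^sub>+\<^sub>1 = t ^ i\<close> with \<open>0 < t < 1\<close> are summable, so they define elements of the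
  subspace (\<open>mix_summable\<close>; completeness of \<open>E\<close> enters here). These elements are linearly
  independent by a Vandermonde argument (\<open>powers_independent\<close>).
\<close>

section \<open>Scalars and scalar sequences\<close>

text \<open>Scalars are known only through an isometric copy of \<open>\<real>\<close> or \<open>\<complex>\<close>, so completeness is pulled back.\<close>

lemma convergent_if_Cauchy_isometry:
  fixes f :: "'a::real_normed_vector \<Rightarrow> 'b::banach"
  assumes "bij f" and add: "\<And>x y. f (x + y) = f x + f y" and norm: "\<And>x. norm (f x) = norm x"
    and "Cauchy (a :: nat \<Rightarrow> 'a)"
  shows "convergent a"
proof -
  have diff: "norm (f x - f y) = norm (x - y)" for x y
  proof -
    have "f x = f (x - y) + f y"
      using add[of "x - y" y] by simp
    then show ?thesis
      using norm[of "x - y"] by simp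
  qed
  have "Cauchy (f \<circ> a)"
    using \<open>Cauchy a\<close> by (simp add: Cauchy_iff diff)
  then obtain l where "(f \<circ> a) \<longlonglongrightarrow> l"
    using Cauchy_convergent convergentD by blast
  moreover obtain l' where "l = f l'"
    using \<open>bij f\<close> by (meson bij_pointE)
  ultimately have "a \<longlonglongrightarrow> l'"
    by (simp add: LIMSEQ_iff diff)
  then show ?thesis
    by (rule convergentI)
qed

lemma Cauchy_convergent_real_or_complex:
  fixes a :: "nat \<Rightarrow> 'k::real_or_complex"
  assumes "Cauchy a"
  shows "convergent a"
  using real_or_complex[where 'a='k] assms
    convergent_if_Cauchy_isometry[of "_ :: 'k \<Rightarrow> real" a]
    convergent_if_Cauchy_isometry[of "_ :: 'k \<Rightarrow> complex" a] by blast

text \<open>A sequence of pairs of sets of naturals is a set of tagged pairs of naturals, and hence a set of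
  naturals; thus a countable power of the continuum is the continuum.\<close>

lemma card_of_scalar_sequences: "|UNIV :: (nat \<Rightarrow> 'k::real_or_complex) set| \<le>o |UNIV :: real set|"
proof -
  obtain f :: "'k \<Rightarrow> complex" where f: "inj f"
  proof -
    have "inj (complex_of_real \<circ> g)" if "bij g" for g :: "'k \<Rightarrow> real"
      using that by (auto simp: inj_on_def bij_def)
    then show thesis
      using real_or_complex[where 'a='k] that bij_is_inj by blast
  qed
  obtain g :: "real \<Rightarrow> nat set" where g: "inj g"
    using nat_sets_eqpoll_reals eqpoll_imp_lepoll eqpoll_sym unfolding lepoll_def by blast
  define h :: "(nat \<Rightarrow> 'k) \<Rightarrow> (nat \<times> nat + nat \<times> nat) set" where
    "h a = {Inl (n, m) |n m. m \<in> g (Re (f (a n)))} \<union> {Inr (n, m) |n m. m \<in> g (Im (f (a n)))}" for a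
  have "inj h"
  proof (rule injI)
    fix a b assume "h a = h b"
    have "a n = b n" for n
    proof -
      have "g (Re (f (a n))) = {m. Inl (n, m) \<in> h a}" "g (Im (f (a n))) = {m. Inr (n, m) \<in> h a}"
        "g (Re (f (b n))) = {m. Inl (n, m) \<in> h b}" "g (Im (f (b n))) = {m. Inr (n, m) \<in> h b}"
        by (auto simp: h_def)
      then have "Re (f (a n)) = Re (f (b n))" "Im (f (a n)) = Im (f (b n))"
        using g \<open>h a = h b\<close> by (metis injD)+
      then show ?thesis
        using f by (simp add: complex_eq_iff injD)
    qed
    then show "a = b" ..
  qed
  moreover have "inj (image (to_nat :: nat \<times> nat + nat \<times> nat \<Rightarrow> nat))"
    by (simp add: inj_image_eq_iff inj_on_def)
  moreover obtain k :: "nat set \<Rightarrow> real" where "inj k"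
    using nat_sets_eqpoll_reals eqpoll_imp_lepoll unfolding lepoll_def by blast
  ultimately have "inj (k \<circ> image to_nat \<circ> h)"
    by (intro inj_compose)
  then show ?thesis
    by (subst card_of_ordLeq[symmetric]) blast
qed

text \<open>By linearity the power \<open>t ^ i\<close> may be replaced by \<open>p t\<close> for any polynomial \<open>p\<close>; one that
  vanishes at all points of \<open>F\<close> except \<open>s\<close> isolates \<open>c s\<close>.\<close>

lemma powers_independent:
  fixes c :: "real \<Rightarrow> 'k::real_normed_field"
  assumes "finite F" and zero: "\<And>i::nat. (\<Sum>t\<in>F. c t * of_real t ^ i) = 0" and "s \<in> F"
  shows "c s = 0"
proof -
  have *: "(\<Sum>t\<in>F. c t * poly p (of_real t)) = 0" for p
  proof -
    have "(\<Sum>t\<in>F. c t * poly p (of_real t))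
        = (\<Sum>t\<in>F. \<Sum>i\<le>degree p. coeff p i * (c t * of_real t ^ i))"
      by (simp add: poly_altdef sum_distrib_left algebra_simps)
    also have "\<dots> = (\<Sum>i\<le>degree p. coeff p i * (\<Sum>t\<in>F. c t * of_real t ^ i))"
      by (subst sum.swap) (simp add: sum_distrib_left)
    finally show ?thesis
      by (simp add: zero)
  qed
  define p :: "'k poly" where "p = (\<Prod>t\<in>F - {s}. [:- of_real t, 1:])"
  have "poly p (of_real t) = 0" if "t \<in> F - {s}" for t
    using assms(1) that by (auto simp: p_def poly_prod prod_zero_iff)
  then have "(\<Sum>t\<in>F. c t * poly p (of_real t)) = c s * poly p (of_real s)"
    using assms by (simp add: sum.remove[of F s])
  moreover have "poly p (of_real s) \<noteq> 0"
    using assms(1) by (auto simp: p_def poly_prod prod_zero_iff)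
  ultimately show ?thesis
    using *[of p] by simp
qed

context banach_space_over
begin

lemma norm_scale_diff: "norm (s c w - s d w) = norm (c - d) * norm w"
  by (simp add: norm_scale flip: scale_left_diff_distrib)

lemma tendsto_scale:
  assumes "c \<longlonglongrightarrow> l"
  shows "(\<lambda>n. s (c n) w) \<longlonglongrightarrow> s l w"
proof -
  have "(\<lambda>n. norm (c n - l) * norm w) \<longlonglongrightarrow> 0"
    using assms by (intro tendsto_mult_left_zero) (simp add: LIM_zero tendsto_norm_zero)
  then show ?thesis
    by (subst LIM_zero_iff[symmetric], subst tendsto_norm_zero_iff[symmetric])
      (simp add: norm_scale_diff)
qed

text \<open>One-dimensional subspaces are complete.\<close>

lemma convergent_scalars:
  assumes "convergent (\<lambda>n. s (c n) w)" and "w \<noteq> 0"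
  shows "convergent c"
proof (rule Cauchy_convergent_real_or_complex)
  have "Cauchy (\<lambda>n. s (c n) w)"
    using assms(1) by (rule convergent_Cauchy)
  show "Cauchy c"
    unfolding Cauchy_iff
  proof (intro allI impI)
    fix e :: real
    assume "e > 0"
    then have "e * norm w > 0"
      using \<open>w \<noteq> 0\<close> by simp
    then obtain M where "\<forall>m\<ge>M. \<forall>n\<ge>M. norm (c m - c n) * norm w < e * norm w"
      using \<open>Cauchy (\<lambda>n. s (c n) w)\<close> unfolding Cauchy_iff norm_scale_diff by blast
    then show "\<exists>M. \<forall>m\<ge>M. \<forall>n\<ge>M. norm (c m - c n) < e"
      using \<open>w \<noteq> 0\<close> by auto
  qed
qed

end

section \<open>The normed space of operators\<close>

context banach_space_on
begin

lemma N_zero [simp]: "N 0 = 0"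
  using N_eq_zero subspace_0[OF subspace_carrier] by blast

lemma N_nonneg: "x \<in> S \<Longrightarrow> 0 \<le> N x"
  using Metric_space.nonneg[OF metric, of x 0] subspace_0[OF subspace_carrier]
  by (simp add: norm_dist_def)

lemma Cauchy_imp_convergent:
  assumes "\<And>n. \<sigma> n \<in> S"
    and "\<And>e. e > 0 \<Longrightarrow> \<exists>M. \<forall>m\<ge>M. \<forall>n\<ge>M. N (\<sigma> m - \<sigma> n) < e"
  shows "\<exists>l\<in>S. (\<lambda>n. N (\<sigma> n - l)) \<longlonglongrightarrow> 0"
proof -
  interpret Metric_space S "norm_dist S N"
    by (rule metric)
  have "MCauchy \<sigma>"
    unfolding MCauchy_def
  proof (intro conjI allI impI)
    show "range \<sigma> \<subseteq> S"
      using assms(1) by blast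
    show "\<exists>M. \<forall>m n. M \<le> m \<longrightarrow> M \<le> n \<longrightarrow> norm_dist S N (\<sigma> m) (\<sigma> n) < e" if "e > 0" for e
      using assms(2)[OF that] assms(1) by (simp add: norm_dist_def)
  qed
  then obtain l where "limitin mtopology \<sigma> l sequentially"
    using complete mcomplete_def by blast
  then have "l \<in> S" "(\<lambda>n. norm_dist S N (\<sigma> n) l) \<longlonglongrightarrow> 0"
    by (simp_all add: limitin_metric_dist_null)
  then show ?thesis
    using assms(1) by (auto simp: norm_dist_def)
qed

end

locale operator_space =
  V: banach_space_over scaleV + banach_space_on s S N
  for scaleV :: "'k::real_or_complex \<Rightarrow> 'v::banach \<Rightarrow> 'v"
    and s :: "'k \<Rightarrow> 'a::ab_group_add \<Rightarrow> 'a" and S :: "'a set" and N :: "'a \<Rightarrow> real"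
begin

sublocale L: vector_space "fun_scale s"
  by (rule vector_space_fun_scale) (rule vector_space_axioms)

abbreviation Ops :: "('v \<Rightarrow> 'a) set" where
  "Ops \<equiv> continuous_operators scaleV s S N"

lemma Ops_in: "T \<in> Ops \<Longrightarrow> T x \<in> S"
  by (auto simp: continuous_operators_def)

lemma Ops_linear: "T \<in> Ops \<Longrightarrow> Vector_Spaces.linear scaleV s T"
  by (simp add: continuous_operators_def)

lemma Ops_add: "T \<in> Ops \<Longrightarrow> T (x + y) = T x + T y"
  by (rule module_hom.add[OF Vector_Spaces.linear.axioms(3)[OF Ops_linear]])

lemma Ops_scale: "T \<in> Ops \<Longrightarrow> T (scaleV c x) = s c (T x)"
  by (rule module_hom.scale[OF Vector_Spaces.linear.axioms(3)[OF Ops_linear]])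

lemma Ops_zero: "T \<in> Ops \<Longrightarrow> T 0 = 0"
  using Ops_add[of T 0 0] by simp

lemma Ops_diff: "T \<in> Ops \<Longrightarrow> T (x - y) = T x - T y"
  using Ops_add[of T "x - y" y] by simp

lemma Ops_bounded:
  assumes T: "T \<in> Ops"
  shows "\<exists>K\<ge>0. \<forall>x. N (T x) \<le> K * norm x"
proof -
  interpret M: Metric_space S "norm_dist S N"
    by (rule metric)
  have "continuous_map euclidean M.mtopology T"
    using T by (simp add: continuous_operators_def norm_topology_def)
  then have "\<exists>U. openin euclidean U \<and> 0 \<in> U \<and> (\<forall>y\<in>U. T y \<in> M.mball (T 0) 1)"
    unfolding M.continuous_map_to_metric by simp
  then obtain U where U: "open U" "0 \<in> U" "\<forall>y\<in>U. T y \<in> M.mball (T 0) 1"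
    by auto
  then obtain d where d: "d > 0" "cball 0 d \<subseteq> U"
    using open_contains_cball by blast
  have small: "N (T y) \<le> 1" if "norm y \<le> d" for y
  proof -
    have "T y \<in> M.mball (T 0) 1"
      using d that U by auto
    then have "norm_dist S N 0 (T y) < 1"
      by (simp add: Ops_zero[OF T])
    then have "norm_dist S N (T y) 0 < 1"
      by (simp only: M.commute)
    then show ?thesis
      using Ops_in[OF T] subspace_0[OF subspace_carrier] by (simp add: norm_dist_def)
  qed
  have "N (T x) \<le> inverse d * norm x" for x
  proof (cases "x = 0")
    case True
    then show ?thesis
      by (simp add: Ops_zero[OF T])
  next
    case False
    define r where "r = d / norm x"
    have "r > 0"
      using False d by (simp add: r_def)
    have "N (T (scaleV (of_real r) x)) \<le> 1"
      using False d by (intro small) (simp add: V.norm_scale r_def norm_divide norm_inverse)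
    then have "r * N (T x) \<le> 1"
      using \<open>r > 0\<close> by (simp add: Ops_scale[OF T] N_scale Ops_in[OF T])
    then show ?thesis
      using False d by (simp add: r_def field_simps)
  qed
  then show ?thesis
    using d by (meson inverse_nonnegative_iff_nonnegative less_imp_le)
qed

lemma OpsI:
  assumes "\<And>x. T x \<in> S" and add: "\<And>x y. T (x + y) = T x + T y"
    and scale: "\<And>c x. T (scaleV c x) = s c (T x)" and bound: "\<And>x. N (T x) \<le> K * norm x"
  shows "T \<in> Ops"
proof -
  interpret M: Metric_space S "norm_dist S N"
    by (rule metric)
  have lin: "Vector_Spaces.linear scaleV s T"
    by (intro Vector_Spaces.linear.intro module_hom.intro module_hom_axioms.intro add scale
        vector_space_axioms V.vector_space_axioms V.module_axioms module_axioms)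
  have diff: "T (y - x) = T y - T x" for x y
    using add[of "y - x" x] by simp
  have "continuous_map euclidean M.mtopology T"
    unfolding M.continuous_map_to_metric
  proof (intro ballI allI impI)
    fix x :: 'v and e :: real
    assume "e > 0"
    define d where "d = e / (\<bar>K\<bar> + 1)"
    have "d > 0"
      using \<open>e > 0\<close> by (simp add: d_def)
    have "T y \<in> M.mball (T x) e" if "y \<in> ball x d" for y
    proof -
      have "N (T x - T y) \<le> K * norm (x - y)"
        using bound[of "x - y"] by (simp add: diff)
      also have "\<dots> \<le> (\<bar>K\<bar> + 1) * norm (x - y)"
        by (intro mult_right_mono) auto
      also have "\<dots> < (\<bar>K\<bar> + 1) * d"
        using that by (intro mult_strict_left_mono) (auto simp: dist_norm)
      also have "\<dots> = e"
        by (simp add: d_def)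
      finally show ?thesis
        by (simp add: assms(1) norm_dist_def)
    qed
    then show "\<exists>U. openin euclidean U \<and> x \<in> U \<and> (\<forall>y\<in>U. T y \<in> M.mball (T x) e)"
      using \<open>d > 0\<close> by (intro exI[of _ "ball x d"]) auto
  qed
  then show ?thesis
    using assms(1) lin by (auto simp: continuous_operators_def norm_topology_def)
qed

lemma subspace_Ops: "L.subspace Ops"
proof (rule L.subspaceI)
  show "0 \<in> Ops"
    by (rule OpsI[where K=0]) (auto simp: subspace_0[OF subspace_carrier])
  show "T + R \<in> Ops" if T: "T \<in> Ops" and R: "R \<in> Ops" for T R
  proof -
    obtain K K' where K: "\<And>x. N (T x) \<le> K * norm x" "\<And>x. N (R x) \<le> K' * norm x"
      using Ops_bounded[OF T] Ops_bounded[OF R] by blast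
    show ?thesis
    proof (rule OpsI[where K="K + K'"])
      show "N ((T + R) x) \<le> (K + K') * norm x" for x
        using N_triangle[OF Ops_in[OF T] Ops_in[OF R], of x x] K[of x]
        by (simp add: distrib_right)
    qed (simp_all add: Ops_add T R Ops_scale Ops_in subspace_add[OF subspace_carrier]
        scale_right_distrib)
  qed
  show "fun_scale s c T \<in> Ops" if T: "T \<in> Ops" for c T
  proof -
    obtain K where K: "\<And>x. N (T x) \<le> K * norm x"
      using Ops_bounded[OF T] by blast
    show ?thesis
    proof (rule OpsI[where K="norm c * K"])
      show "N (fun_scale s c T x) \<le> norm c * K * norm x" for x
        using mult_left_mono[OF K[of x], of "norm c"]
        by (simp add: fun_scale_def N_scale Ops_in T)
    qed (simp_all add: fun_scale_def Ops_add[OF T] Ops_scale[OF T] Ops_in[OF T]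
        subspace_scale[OF subspace_carrier] scale_right_distrib mult.commute)
  qed
qed

lemma bdd_above_operator_norm:
  assumes "T \<in> Ops"
  shows "bdd_above ((\<lambda>x. N (T x)) ` cball 0 1)"
proof -
  obtain K where K: "K \<ge> 0" "\<And>x. N (T x) \<le> K * norm x"
    using Ops_bounded[OF assms] by blast
  have "N (T x) \<le> K" if "x \<in> cball 0 1" for x
    using K(2)[of x] mult_left_mono[of "norm x" 1 K] K(1) that by simp
  then show ?thesis
    by (rule bdd_aboveI2)
qed

lemma operator_norm_ge: "T \<in> Ops \<Longrightarrow> norm x \<le> 1 \<Longrightarrow> N (T x) \<le> operator_norm N T"
  unfolding operator_norm_def by (intro cSUP_upper bdd_above_operator_norm) auto

lemma operator_norm_le: "(\<And>x. norm x \<le> 1 \<Longrightarrow> N (T x) \<le> K) \<Longrightarrow> operator_norm N T \<le> K"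
  unfolding operator_norm_def by (intro cSUP_least) auto

lemma operator_norm_nonneg: "T \<in> Ops \<Longrightarrow> 0 \<le> operator_norm N T"
  using operator_norm_ge[of T 0] by (simp add: Ops_zero)

lemma N_le_operator_norm:
  assumes T: "T \<in> Ops"
  shows "N (T x) \<le> operator_norm N T * norm x"
proof (cases "x = 0")
  case False
  define r where "r = inverse (norm x)"
  have "r > 0"
    using False by (simp add: r_def)
  have "N (T (scaleV (of_real r) x)) \<le> operator_norm N T"
    using False by (intro operator_norm_ge[OF T]) (simp add: V.norm_scale r_def norm_divide norm_inverse)
  then have "r * N (T x) \<le> operator_norm N T"
    using \<open>r > 0\<close> by (simp add: Ops_scale[OF T] N_scale Ops_in[OF T])
  then show ?thesis
    using False by (simp add: r_def field_simps)
qed (simp add: Ops_zero T)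

lemma Metric_space_Ops: "Metric_space Ops (norm_dist Ops (operator_norm N))"
proof
  have diff: "T - R \<in> Ops" if "T \<in> Ops" "R \<in> Ops" for T R
    using L.subspace_diff[OF subspace_Ops that] .
  have sym: "operator_norm N (T - R) = operator_norm N (R - T)" if "T \<in> Ops" "R \<in> Ops" for T R
  proof -
    have "N ((T - R) x) = N ((R - T) x)" for x
      using N_scale[of "(R - T) x" "- 1"] Ops_in[OF diff] that by simp
    then show ?thesis
      by (simp add: operator_norm_def)
  qed
  show "0 \<le> norm_dist Ops (operator_norm N) T R" for T R
    by (simp add: norm_dist_def operator_norm_nonneg diff)
  show "norm_dist Ops (operator_norm N) T R = norm_dist Ops (operator_norm N) R T" for T R
    by (simp add: norm_dist_def sym)
  show "norm_dist Ops (operator_norm N) T R = 0 \<longleftrightarrow> T = R" if T: "T \<in> Ops" and R: "R \<in> Ops" for T R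
  proof
    assume "norm_dist Ops (operator_norm N) T R = 0"
    then have "N ((T - R) x) \<le> 0" for x
      using N_le_operator_norm[OF diff[OF T R], of x] T R by (simp add: norm_dist_def)
    then have "(T - R) x = 0" for x
      using N_eq_zero N_nonneg Ops_in[OF diff[OF T R]] by (meson order_antisym)
    then show "T = R"
      by (simp add: fun_eq_iff)
  next
    assume "T = R"
    then show "norm_dist Ops (operator_norm N) T R = 0"
      by (simp add: norm_dist_def operator_norm_def)
  qed
  show "norm_dist Ops (operator_norm N) T Q
      \<le> norm_dist Ops (operator_norm N) T R + norm_dist Ops (operator_norm N) R Q"
    if T: "T \<in> Ops" and R: "R \<in> Ops" and Q: "Q \<in> Ops" for T R Q
  proof -
    have "operator_norm N (T - Q) \<le> operator_norm N (T - R) + operator_norm N (R - Q)"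
    proof (rule operator_norm_le)
      fix x :: 'v
      assume x: "norm x \<le> 1"
      have "N ((T - R) x + (R - Q) x) \<le> N ((T - R) x) + N ((R - Q) x)"
        by (intro N_triangle Ops_in diff T R Q)
      then show "N ((T - Q) x) \<le> operator_norm N (T - R) + operator_norm N (R - Q)"
        using operator_norm_ge[OF diff[OF T R] x] operator_norm_ge[OF diff[OF R Q] x] by simp
    qed
    then show ?thesis
      by (simp add: norm_dist_def T R Q)
  qed
qed

lemma topspace_operator_topology: "topspace (operator_topology scaleV s S N) = Ops"
  by (simp add: operator_topology_def norm_topology_def
      Metric_space.topspace_mtopology[OF Metric_space_Ops])

text \<open>Norm convergence of operators implies pointwise convergence, so a set that is closed under
  pointwise limits of sequences is closed.\<close>

lemma closedin_operator_topologyI: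
  assumes "W \<subseteq> Ops"
    and limit: "\<And>\<sigma> R. (\<And>n. \<sigma> n \<in> W) \<Longrightarrow> R \<in> Ops \<Longrightarrow>
      (\<And>x. (\<lambda>n. N (\<sigma> n x - R x)) \<longlonglongrightarrow> 0) \<Longrightarrow> R \<in> W"
  shows "closedin (operator_topology scaleV s S N) W"
proof -
  interpret M: Metric_space Ops "norm_dist Ops (operator_norm N)"
    by (rule Metric_space_Ops)
  have "R \<in> W" if \<sigma>: "range \<sigma> \<subseteq> W" and lim: "limitin M.mtopology \<sigma> R sequentially" for \<sigma> R
  proof (rule limit)
    show W: "\<sigma> n \<in> W" for n
      using \<sigma> by blast
    show R: "R \<in> Ops"
      using lim by (simp add: M.limitin_metric_dist_null)
    show "(\<lambda>n. N (\<sigma> n x - R x)) \<longlonglongrightarrow> 0" for x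
    proof (rule tendsto_sandwich)
      have diff: "\<sigma> n - R \<in> Ops" for n
        using L.subspace_diff[OF subspace_Ops _ R] W assms(1) by blast
      show "\<forall>\<^sub>F n in sequentially. 0 \<le> N (\<sigma> n x - R x)"
        using N_nonneg[OF Ops_in[OF diff]] by simp
      show "\<forall>\<^sub>F n in sequentially. N (\<sigma> n x - R x) \<le> norm_dist Ops (operator_norm N) (\<sigma> n) R * norm x"
        using N_le_operator_norm[OF diff, of _ x] subsetD[OF assms(1) W] R
        by (simp add: norm_dist_def)
      show "(\<lambda>n. norm_dist Ops (operator_norm N) (\<sigma> n) R * norm x) \<longlonglongrightarrow> 0"
        using lim by (intro tendsto_mult_left_zero) (simp add: M.limitin_metric_dist_null)
    qed simp
  qed
  then show ?thesis
    unfolding operator_topology_def norm_topology_def M.metric_closedin_iff_sequentially_closed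
    using assms(1) by blast
qed

end

section \<open>Spreading a sequence over disjoint index sets\<close>

text \<open>The successor keeps index \<open>0\<close> outside all the sets; this gives the strict inequality
  \<open>k < position i k\<close>, on which the induction in \<open>mix_eq_0\<close> rests.\<close>

definition position :: "nat \<Rightarrow> nat \<Rightarrow> nat" where
  "position i k = Suc (prod_encode (i, k))"

lemma position_eq_iff [simp]: "position i k = position i' k' \<longleftrightarrow> i = i' \<and> k = k'"
  by (simp add: position_def)

lemma position_nonzero [simp]: "position i k \<noteq> 0" "0 \<noteq> position i k"
  by (simp_all add: position_def)

lemma position_cases:
  obtains "n = 0" | i k where "n = position i k"
proof (cases n)
  case (Suc m)
  then show ?thesis
    using that(2)[of "fst (prod_decode m)" "snd (prod_decode m)"] by (simp add: position_def)
qed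

lemma position_greater: "k < position i k"
  using le_prod_encode_2 by (simp add: position_def less_Suc_eq_le)

lemma strict_mono_position: "strict_mono (position i)"
  by (auto simp: strict_mono_Suc_iff position_def prod_encode_def)

context standard_banach_sequence_space
begin

text \<open>Each coordinate of the formal operator \<open>a\<^sub>0 + \<Sum>i. a\<^sub>i\<^sub>+\<^sub>1 S\<^sub>i\<close> involves at most two coefficients,
  so it makes sense for arbitrary \<open>a\<close>, even if the series diverges in \<open>E\<close>.\<close>

definition mix :: "(nat \<Rightarrow> 'k) \<Rightarrow> (nat \<Rightarrow> 'x) \<Rightarrow> nat \<Rightarrow> 'x" where
  "mix a y n = scaleX (a 0) (y n) +
    (case n of 0 \<Rightarrow> 0 | Suc m \<Rightarrow> (case prod_decode m of (i, k) \<Rightarrow> scaleX (a (Suc i)) (y k)))"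

lemma mix_0: "mix a y 0 = scaleX (a 0) (y 0)"
  by (simp add: mix_def)

lemma mix_position:
  "mix a y (position i k) = scaleX (a 0) (y (position i k)) + scaleX (a (Suc i)) (y k)"
  by (simp add: mix_def position_def)

lemma eq_at_positionsI:
  assumes "f 0 = g 0" "\<And>i k. f (position i k) = g (position i k)"
  shows "f = g"
proof
  show "f n = g n" for n
    by (cases n rule: position_cases) (simp_all add: assms)
qed

lemma mix_add: "mix a (y + z) = mix a y + mix a z"
  by (rule eq_at_positionsI) (simp_all add: mix_0 mix_position X.scale_right_distrib)

lemma mix_scale: "mix a (fun_scale scaleX c y) = fun_scale scaleX c (mix a y)"
  by (rule eq_at_positionsI)
    (simp_all add: fun_scale_def mix_0 mix_position X.scale_right_distrib mult.commute)

lemma mix_add_coeffs: "mix (\<lambda>i. a i + b i) y = mix a y + mix b y"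
  by (rule eq_at_positionsI) (simp_all add: mix_0 mix_position X.scale_left_distrib)

lemma mix_scale_coeffs: "mix (\<lambda>i. c * a i) y = fun_scale scaleX c (mix a y)"
  by (rule eq_at_positionsI)
    (simp_all add: fun_scale_def mix_0 mix_position X.scale_right_distrib)

lemma mix_zero_coeffs: "mix (\<lambda>i. 0) y = 0"
  by (rule eq_at_positionsI) (simp_all add: mix_0 mix_position)

lemma mix_identity: "mix (\<lambda>i. if i = 0 then 1 else 0) y = y"
  by (rule eq_at_positionsI) (simp_all add: mix_0 mix_position)

text \<open>If \<open>a 0 = 0\<close>, a nonzero \<open>a (Suc i)\<close> exhibits a scaled copy of \<open>y\<close> at the positions
  \<open>position i k\<close>. Otherwise \<open>y\<close> at \<open>position i k\<close> is a multiple of \<open>y\<close> at the smaller index \<open>k\<close>, and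
  \<open>y\<close> vanishes at \<open>0\<close>.\<close>

lemma mix_eq_0:
  assumes zero: "mix a y = 0" and "a \<noteq> (\<lambda>i. 0)"
  shows "y = 0"
proof (cases "a 0 = 0")
  case True
  then obtain i where i: "a (Suc i) \<noteq> 0"
    using \<open>a \<noteq> (\<lambda>i. 0)\<close> by (metis ext not0_implies_Suc)
  have "mix a y (position i k) = 0" for k
    using zero by simp
  then have "y k = 0" for k
    using True i by (simp add: mix_position)
  then show ?thesis
    by (simp add: fun_eq_iff)
next
  case False
  have "y n = 0" for n
  proof (induction n rule: less_induct)
    case (less n)
    have "mix a y n = 0"
      using zero by simp
    then show ?case
    proof (cases n rule: position_cases)
      case (2 i k)
      then have "y k = 0"
        using less position_greater by blast
      then show ?thesis
        using 2 \<open>mix a y n = 0\<close> False by (simp add: mix_position)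
    qed (use False in \<open>simp add: mix_0\<close>)
  qed
  then show ?thesis
    by (simp add: fun_eq_iff)
qed

text \<open>Below the first index \<open>m\<close> with \<open>y m \<noteq> 0\<close> there is nothing to shift, so coordinate \<open>m\<close> of a
  mixed sequence sees only the coefficient \<open>a 0\<close>. Once \<open>a 0\<close> is under control, coordinate
  \<open>position i m\<close> gives \<open>a (Suc i)\<close>.\<close>

lemma convergent_coeffs:
  assumes "y \<noteq> 0" and conv: "\<And>j. convergent (\<lambda>n. mix (a n) y j)"
  shows "convergent (\<lambda>n. a n i)"
proof -
  define m where "m = (LEAST m. y m \<noteq> 0)"
  obtain m' where "y m' \<noteq> 0"
    using \<open>y \<noteq> 0\<close> by (auto simp: fun_eq_iff)
  then have m: "y m \<noteq> 0"
    unfolding m_def by (rule LeastI)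
  have below: "y k = 0" if "k < m" for k
    using that not_less_Least unfolding m_def by blast
  have "mix (a n) y m = scaleX (a n 0) (y m)" for n
    by (cases m rule: position_cases) (use below position_greater in \<open>auto simp: mix_0 mix_position\<close>)
  then have 0: "convergent (\<lambda>n. a n 0)"
    using conv[of m] m X.convergent_scalars by simp
  show ?thesis
  proof (cases i)
    case (Suc i')
    obtain l where "(\<lambda>n. a n 0) \<longlonglongrightarrow> l"
      using 0 convergentD by blast
    then have "convergent (\<lambda>n. scaleX (a n 0) (y (position i' m)))"
      using X.tendsto_scale convergentI by blast
    then have "convergent (\<lambda>n. mix (a n) y (position i' m) - scaleX (a n 0) (y (position i' m)))"
      by (intro convergent_diff conv)
    then show ?thesis
      using m X.convergent_scalars Suc by (simp add: mix_position)
  qed (use 0 in simp)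
qed

lemma tendsto_mix:
  assumes "\<And>i. (\<lambda>n. a n i) \<longlonglongrightarrow> b i"
  shows "(\<lambda>n. mix (a n) y j) \<longlonglongrightarrow> mix b y j"
proof (cases j rule: position_cases)
  case 1
  then show ?thesis
    using X.tendsto_scale[OF assms] by (simp add: mix_0)
next
  case (2 i k)
  then show ?thesis
    using tendsto_add[OF X.tendsto_scale[OF assms] X.tendsto_scale[OF assms]]
    by (simp add: mix_position)
qed

section \<open>Convergence of mixed sequences in E\<close>

lemma tendsto_coordinate:
  assumes "\<And>n. \<sigma> n \<in> E" "l \<in> E" "(\<lambda>n. N (\<sigma> n - l)) \<longlonglongrightarrow> 0"
  shows "(\<lambda>n. \<sigma> n j) \<longlonglongrightarrow> l j"
proof -
  obtain C where C: "\<And>x j. x \<in> E \<Longrightarrow> norm (x j) \<le> C * N x"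
    using coordinate_bound by blast
  have "\<sigma> n - l \<in> E" for n
    by (intro subspace_diff[OF subspace_carrier] assms)
  then have "norm (\<sigma> n j - l j) \<le> C * N (\<sigma> n - l)" for n
    using C[of "\<sigma> n - l" j] by simp
  moreover have "(\<lambda>n. C * N (\<sigma> n - l)) \<longlonglongrightarrow> 0"
    by (rule tendsto_mult_right_zero) (rule assms)
  ultimately have "(\<lambda>n. \<sigma> n j - l j) \<longlonglongrightarrow> 0"
    using Lim_null_comparison[of "\<lambda>n. \<sigma> n j - l j" "\<lambda>n. C * N (\<sigma> n - l)" sequentially]
    by simp
  then show ?thesis
    by (rule LIM_zero_cancel)
qed

text \<open>The single summands of \<open>mix\<close>, in the form in which the axioms of \<open>E\<close> bound them; index \<open>0\<close> is
  the identity, to match the numbering of the coefficients.\<close>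

definition shift :: "nat \<Rightarrow> (nat \<Rightarrow> 'x) \<Rightarrow> nat \<Rightarrow> 'x" where
  "shift j y = (case j of 0 \<Rightarrow> y
    | Suc i \<Rightarrow> (\<lambda>n. if n \<in> range (position i) then y (inv (position i) n) else 0))"

lemma shift_0: "shift 0 y = y"
  by (simp add: shift_def)

lemma shift_Suc_0: "shift (Suc i) y 0 = 0"
  by (auto simp: shift_def)

lemma shift_bound: "y \<in> E \<Longrightarrow> shift j y \<in> E \<and> N (shift j y) \<le> N y"
proof (cases j)
  case (Suc i)
  then show "y \<in> E \<Longrightarrow> ?thesis"
    using spread[OF _ strict_mono_position, of y i] by (simp add: shift_def)
qed (simp add: shift_0)

lemmas shift_in = shift_bound[THEN conjunct1] and N_shift = shift_bound[THEN conjunct2]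

lemma shift_Suc_position: "shift (Suc i) y (position i' k) = (if i' = i then y k else 0)"
proof -
  have "inj (position i)"
    by (simp add: inj_on_def)
  then show ?thesis
    by (auto simp: shift_def)
qed

lemma mix_insert:
  assumes "j \<notin> F"
  shows "mix (\<lambda>i. if i \<in> insert j F then a i else 0) y =
    mix (\<lambda>i. if i \<in> F then a i else 0) y + fun_scale scaleX (a j) (shift j y)"
proof (rule eq_at_positionsI)
  show "mix (\<lambda>i. if i \<in> insert j F then a i else 0) y 0 =
    (mix (\<lambda>i. if i \<in> F then a i else 0) y + fun_scale scaleX (a j) (shift j y)) 0"
    using assms by (cases j) (auto simp: mix_0 fun_scale_def shift_0 shift_Suc_0)
  show "mix (\<lambda>i. if i \<in> insert j F then a i else 0) y (position i k) =
    (mix (\<lambda>i. if i \<in> F then a i else 0) y + fun_scale scaleX (a j) (shift j y)) (position i k)" for i k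
    using assms
    by (cases j) (auto simp: mix_position fun_scale_def shift_Suc_position shift_0)
qed

lemma mix_finite:
  assumes "finite F" and y: "y \<in> E"
  shows "mix (\<lambda>i. if i \<in> F then a i else 0) y \<in> E \<and>
    N (mix (\<lambda>i. if i \<in> F then a i else 0) y) \<le> (\<Sum>i\<in>F. norm (a i)) * N y"
  using \<open>finite F\<close>
proof (induction F)
  case empty
  have "mix (\<lambda>i. if i \<in> {} then a i else 0) y = 0"
    unfolding empty_iff if_False by (rule mix_zero_coeffs)
  then show ?case
    using subspace_0[OF subspace_carrier] by (simp only: sum.empty N_zero mult_zero_left order_refl
        simp_thms)
next
  case (insert j F)
  let ?m = "mix (\<lambda>i. if i \<in> F then a i else 0) y" and ?s = "fun_scale scaleX (a j) (shift j y)"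
  have s: "?s \<in> E"
    by (intro subspace_scale[OF subspace_carrier] shift_in y)
  have "N ?s \<le> norm (a j) * N y"
    by (simp add: N_scale shift_in y N_shift mult_left_mono)
  moreover have "N (?m + ?s) \<le> N ?m + N ?s"
    using insert.IH s by (intro N_triangle) auto
  ultimately have "N (?m + ?s) \<le> (\<Sum>i\<in>insert j F. norm (a i)) * N y"
    using insert by (simp add: distrib_right)
  moreover have "?m + ?s \<in> E"
    using insert.IH s by (intro subspace_add[OF subspace_carrier]) auto
  ultimately show ?case
    unfolding mix_insert[OF insert.hyps(2)] by blast
qed

text \<open>Truncating the coefficients gives a Cauchy sequence in \<open>E\<close>, because shifts are contractions.
  Its limit in \<open>E\<close> is also its coordinatewise limit, and the latter is \<open>mix a y\<close>.\<close>

lemma mix_summable: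
  assumes sum: "summable (\<lambda>i. norm (a i))" and y: "y \<in> E"
  shows "mix a y \<in> E" and "N (mix a y) \<le> (\<Sum>i. norm (a i)) * N y"
proof -
  define P where "P n = mix (\<lambda>i. if i \<in> {..<n} then a i else 0) y" for n
  have P: "P n \<in> E" "N (P n) \<le> (\<Sum>i<n. norm (a i)) * N y" for n
    using mix_finite[of "{..<n}" y a] y by (simp_all add: P_def)
  have diff: "P n - P m = mix (\<lambda>i. if i \<in> {m..<n} then a i else 0) y" if "m \<le> n" for m n
  proof -
    have "(\<lambda>i. if i \<in> {..<n} then a i else 0) =
      (\<lambda>i. (if i \<in> {..<m} then a i else 0) + (if i \<in> {m..<n} then a i else 0))"
      using that by auto
    then show ?thesis
      by (simp only: P_def mix_add_coeffs) simp
  qed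
  have small: "\<exists>M. \<forall>m\<ge>M. \<forall>n\<ge>M. N (P m - P n) < e" if "e > 0" for e
  proof -
    have "e / (N y + 1) > 0"
      using that N_nonneg[OF y] by simp
    then obtain M where M: "\<And>m n. m \<ge> M \<Longrightarrow> norm (\<Sum>i=m..<n. norm (a i)) < e / (N y + 1)"
      using sum unfolding summable_Cauchy by blast
    have le: "N (P n - P m) < e" if "M \<le> m" "m \<le> n" for m n
    proof -
      have "N (P n - P m) \<le> (\<Sum>i=m..<n. norm (a i)) * N y"
        using mix_finite[of "{m..<n}" y a] y diff[OF \<open>m \<le> n\<close>] by simp
      also have "\<dots> \<le> (\<Sum>i=m..<n. norm (a i)) * (N y + 1)"
        by (intro mult_left_mono sum_nonneg) auto
      also have "\<dots> < e"
        using M[OF \<open>M \<le> m\<close>, of n] N_nonneg[OF y] by (simp add: sum_nonneg pos_less_divide_eq)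
      finally show ?thesis .
    qed
    have "N (P m - P n) = N (P n - P m)" for m n
      using N_scale[of "P n - P m" "- 1"] subspace_diff[OF subspace_carrier P(1) P(1)] by simp
    then have "N (P m - P n) < e" if "m \<ge> M" "n \<ge> M" for m n
      using le that by (metis linear)
    then show ?thesis
      by blast
  qed
  obtain l where l: "l \<in> E" "(\<lambda>n. N (P n - l)) \<longlonglongrightarrow> 0"
    using Cauchy_imp_convergent[OF P(1) small] by blast
  have "l j = mix a y j" for j
  proof (rule LIMSEQ_unique)
    show "(\<lambda>n. P n j) \<longlonglongrightarrow> l j"
      by (rule tendsto_coordinate) (use P l in auto)
    have "(\<lambda>n. if i \<in> {..<n} then a i else 0) \<longlonglongrightarrow> a i" for i
      by (rule tendsto_eventually, rule eventually_sequentiallyI[of "Suc i"]) simp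
    then show "(\<lambda>n. P n j) \<longlonglongrightarrow> mix a y j"
      unfolding P_def by (intro tendsto_mix)
  qed
  then have "l = mix a y" ..
  then show "mix a y \<in> E"
    using l by simp
  have "N l \<le> N (P n - l) + (\<Sum>i. norm (a i)) * N y" for n
  proof -
    have "N l = N (P n + (l - P n))"
      by (simp only: add.commute[of "P n"] diff_add_cancel)
    also have "\<dots> \<le> N (P n) + N (l - P n)"
      by (intro N_triangle P subspace_diff[OF subspace_carrier] l)
    also have "N (l - P n) = N (P n - l)"
      using N_scale[of "P n - l" "- 1"] subspace_diff[OF subspace_carrier P(1) l(1)] by simp
    also have "N (P n) \<le> (\<Sum>i. norm (a i)) * N y"
      using P(2)[of n] mult_right_mono[OF sum_le_suminf[OF sum, of "{..<n}"] N_nonneg[OF y]] by simp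
    finally show ?thesis
      by (simp only: add.commute)
  qed
  moreover have "(\<lambda>n. N (P n - l) + (\<Sum>i. norm (a i)) * N y) \<longlonglongrightarrow> 0 + (\<Sum>i. norm (a i)) * N y"
    by (intro tendsto_add l tendsto_const)
  ultimately have "N l \<le> 0 + (\<Sum>i. norm (a i)) * N y"
    by (intro LIMSEQ_le_const) auto
  then show "N (mix a y) \<le> (\<Sum>i. norm (a i)) * N y"
    by (simp add: \<open>l = mix a y\<close>)
qed

end

section \<open>The subspace generated by an injective operator\<close>

locale sequence_space_operators =
  V: banach_space_over scaleV + standard_banach_sequence_space scaleX E N
  for scaleV :: "'k::real_or_complex \<Rightarrow> 'v::banach \<Rightarrow> 'v"
    and scaleX :: "'k \<Rightarrow> 'x::banach \<Rightarrow> 'x"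
    and E :: "(nat \<Rightarrow> 'x) set" and N :: "(nat \<Rightarrow> 'x) \<Rightarrow> real"
begin

sublocale operator_space scaleV "fun_scale scaleX" E N
  by unfold_locales

text \<open>No summability of \<open>a\<close> is demanded, only boundedness of the resulting operator: closedness needs
  a condition that survives coordinatewise limits of coefficients.\<close>

definition mixes :: "('v \<Rightarrow> nat \<Rightarrow> 'x) \<Rightarrow> ('v \<Rightarrow> nat \<Rightarrow> 'x) set" where
  "mixes T = {R \<in> Ops. \<exists>a. R = (\<lambda>x. mix a (T x))}"

lemma mix_in_mixes:
  assumes T: "T \<in> Ops" and a: "summable (\<lambda>i. norm (a i))"
  shows "(\<lambda>x. mix a (T x)) \<in> mixes T"
proof -
  obtain K where K: "K \<ge> 0" "\<And>x. N (T x) \<le> K * norm x"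
    using Ops_bounded[OF T] by blast
  have "(\<lambda>x. mix a (T x)) \<in> Ops"
  proof (rule OpsI[where K="(\<Sum>i. norm (a i)) * K"])
    fix x
    have "N (mix a (T x)) \<le> (\<Sum>i. norm (a i)) * N (T x)"
      by (intro mix_summable a Ops_in T)
    also have "\<dots> \<le> (\<Sum>i. norm (a i)) * (K * norm x)"
      by (intro mult_left_mono K suminf_nonneg a) auto
    finally show "N (mix a (T x)) \<le> (\<Sum>i. norm (a i)) * K * norm x"
      by (simp add: mult.assoc)
  qed (simp_all add: Ops_add[OF T] Ops_scale[OF T] mix_add mix_scale mix_summable(1)[OF a] Ops_in[OF T])
  then show ?thesis
    by (auto simp: mixes_def)
qed

lemma self_in_mixes:
  assumes "T \<in> Ops"
  shows "T \<in> mixes T"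
proof -
  have "T = (\<lambda>x. mix (\<lambda>i. if i = 0 then 1 else 0) (T x))"
    by (simp only: mix_identity)
  then show ?thesis
    using assms unfolding mixes_def by blast
qed

lemma subspace_mixes: "L.subspace (mixes T)"
proof (rule L.subspaceI)
  have "0 = (\<lambda>x. mix (\<lambda>i. 0) (T x))"
    by (simp only: mix_zero_coeffs zero_fun_def)
  then show "0 \<in> mixes T"
    using L.subspace_0[OF subspace_Ops] unfolding mixes_def by blast
  show "R + Q \<in> mixes T" if R: "R \<in> mixes T" and Q: "Q \<in> mixes T" for R Q
  proof -
    obtain a b where "R = (\<lambda>x. mix a (T x))" "Q = (\<lambda>x. mix b (T x))"
      using R Q by (auto simp: mixes_def)
    then have "R + Q = (\<lambda>x. mix (\<lambda>i. a i + b i) (T x))"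
      by (simp only: mix_add_coeffs plus_fun_def)
    moreover have "R + Q \<in> Ops"
      using R Q by (intro L.subspace_add[OF subspace_Ops]) (auto simp: mixes_def)
    ultimately show ?thesis
      unfolding mixes_def by blast
  qed
  show "fun_scale (fun_scale scaleX) c R \<in> mixes T" if R: "R \<in> mixes T" for c R
  proof -
    obtain a where "R = (\<lambda>x. mix a (T x))"
      using R by (auto simp: mixes_def)
    then have "fun_scale (fun_scale scaleX) c R = (\<lambda>x. mix (\<lambda>i. c * a i) (T x))"
      by (simp only: mix_scale_coeffs fun_scale_def[of "fun_scale scaleX"])
    moreover have "fun_scale (fun_scale scaleX) c R \<in> Ops"
      using R by (intro L.subspace_scale[OF subspace_Ops]) (auto simp: mixes_def)
    ultimately show ?thesis
      unfolding mixes_def by blast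
  qed
qed

lemma mixes_injective:
  assumes T: "inj T" "T \<in> Ops" and R: "R \<in> mixes T" and "R \<noteq> 0"
  shows "inj R"
proof (rule injI)
  fix x y
  assume "R x = R y"
  obtain a where a: "R = (\<lambda>x. mix a (T x))"
    using R by (auto simp: mixes_def)
  have "R (x - y) = 0"
    using R \<open>R x = R y\<close> by (subst Ops_diff) (auto simp: mixes_def)
  then have "mix a (T (x - y)) = 0"
    using a by simp
  moreover have "a \<noteq> (\<lambda>i. 0)"
  proof
    assume "a = (\<lambda>i. 0)"
    then have "R = 0"
      unfolding a by (simp only: mix_zero_coeffs zero_fun_def)
    then show False
      using \<open>R \<noteq> 0\<close> by contradiction
  qed
  ultimately have "T (x - y) = 0"
    by (rule mix_eq_0)
  then have "T x = T y"
    by (simp only: Ops_diff[OF T(2)] right_minus_eq)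
  then show "x = y"
    using T(1) by (rule injD[rotated])
qed

text \<open>Evaluation at the single vector \<open>v\<close> makes the coefficients of a convergent sequence of operators
  converge one by one; the limits serve at every other vector.\<close>

lemma closedin_mixes:
  assumes "T v \<noteq> 0"
  shows "closedin (operator_topology scaleV (fun_scale scaleX) E N) (mixes T)"
proof (rule closedin_operator_topologyI)
  show "mixes T \<subseteq> Ops"
    by (auto simp: mixes_def)
  fix \<sigma> R
  assume \<sigma>: "\<And>n. \<sigma> n \<in> mixes T" and R: "R \<in> Ops"
    and lim: "\<And>x. (\<lambda>n. N (\<sigma> n x - R x)) \<longlonglongrightarrow> 0"
  have "\<exists>a. \<forall>n. \<sigma> n = (\<lambda>x. mix (a n) (T x))"
    using \<sigma> by (intro choice) (auto simp: mixes_def)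
  then obtain a where a: "\<And>n x. \<sigma> n x = mix (a n) (T x)"
    by metis
  have "mix (a n) (T x) \<in> E" for n x
    using \<sigma>[of n] Ops_in[of "\<sigma> n" x] by (simp add: mixes_def flip: a)
  then have coord: "(\<lambda>n. mix (a n) (T x) j) \<longlonglongrightarrow> R x j" for x j
    using tendsto_coordinate[OF _ Ops_in[OF R], of "\<lambda>n. mix (a n) (T x)" x j] lim[of x]
    unfolding a by blast
  have "convergent (\<lambda>n. a n i)" for i
    using convergent_coeffs[OF assms, of a] coord[of v] convergentI by blast
  then have "\<exists>b. \<forall>i. (\<lambda>n. a n i) \<longlonglongrightarrow> b i"
    by (intro choice) (auto simp: convergent_def)
  then obtain b where "\<And>i. (\<lambda>n. a n i) \<longlonglongrightarrow> b i"
    by blast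
  then have "R x j = mix b (T x) j" for x j
    using LIMSEQ_unique[OF coord tendsto_mix] by blast
  then have "R = (\<lambda>x. mix b (T x))"
    by (simp add: fun_eq_iff)
  then show "R \<in> mixes T"
    using R unfolding mixes_def by blast
qed

lemma card_of_mixes: "|mixes T| \<le>o |UNIV :: real set|"
proof -
  have "mixes T \<subseteq> range (\<lambda>a x. mix a (T x))"
    by (auto simp: mixes_def)
  then have "|mixes T| \<le>o |range (\<lambda>a x. mix a (T x))|"
    by (rule card_of_mono1)
  also have "|range (\<lambda>a x. mix a (T x))| \<le>o |UNIV :: (nat \<Rightarrow> 'k) set|"
    by (rule card_of_image)
  also have "|UNIV :: (nat \<Rightarrow> 'k) set| \<le>o |UNIV :: real set|"
    by (rule card_of_scalar_sequences)
  finally show ?thesis .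
qed

section \<open>The dimension of the subspace\<close>

text \<open>The coefficient of the identity is \<open>0\<close> and the others are the powers of \<open>t\<close>, so that these
  operators are independent for the same reason as geometric sequences.\<close>

definition geometric_mix :: "('v \<Rightarrow> nat \<Rightarrow> 'x) \<Rightarrow> real \<Rightarrow> 'v \<Rightarrow> nat \<Rightarrow> 'x" where
  "geometric_mix T t x = mix (\<lambda>j. case j of 0 \<Rightarrow> 0 | Suc i \<Rightarrow> of_real t ^ i) (T x)"

lemma geometric_mix_position: "geometric_mix T t x (position i k) = scaleX (of_real t ^ i) (T x k)"
  by (simp add: geometric_mix_def mix_position)

lemma geometric_mix_in:
  assumes "T \<in> Ops" "t \<in> {0<..<1}"
  shows "geometric_mix T t \<in> mixes T"
proof -
  have "summable (\<lambda>j. norm ((case j of 0 \<Rightarrow> 0 | Suc i \<Rightarrow> of_real t ^ i) :: 'k))"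
    using assms(2) by (subst summable_Suc_iff[symmetric]) (simp add: norm_power)
  from mix_in_mixes[OF assms(1) this] show ?thesis
    unfolding geometric_mix_def[abs_def] .
qed

lemma inj_geometric_mix:
  assumes "T v \<noteq> 0"
  shows "inj (geometric_mix T)"
proof (rule injI)
  fix t u
  assume eq: "geometric_mix T t = geometric_mix T u"
  obtain k where k: "T v k \<noteq> 0"
    using assms by (auto simp: fun_eq_iff)
  have "scaleX (of_real t) (T v k) = scaleX (of_real u) (T v k)"
    using geometric_mix_position[of T _ v 1 k] eq by (metis power_one_right)
  then show "t = u"
    using k by simp
qed

text \<open>At a coordinate \<open>k\<close> with \<open>T v k \<noteq> 0\<close>, a vanishing linear combination evaluated at
  \<open>position i k\<close> is a vanishing combination of the \<open>i\<close>-th powers, for each \<open>i\<close>.\<close>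

lemma independent_geometric_mix:
  assumes "T v \<noteq> 0"
  shows "L.independent (geometric_mix T ` J)"
  unfolding L.independent_explicit_module
proof (intro allI impI)
  fix F and u :: "('v \<Rightarrow> nat \<Rightarrow> 'x) \<Rightarrow> 'k" and w
  assume "finite F" "F \<subseteq> geometric_mix T ` J"
    and zero: "(\<Sum>w\<in>F. fun_scale (fun_scale scaleX) (u w) w) = 0" and "w \<in> F"
  then obtain G where G: "finite G" "F = geometric_mix T ` G"
    by (meson finite_subset_image)
  obtain k where k: "T v k \<noteq> 0"
    using assms by (auto simp: fun_eq_iff)
  have apply_sum: "(\<Sum>w\<in>F. f w) x n = (\<Sum>w\<in>F. f w x n)" for f :: "_ \<Rightarrow> 'v \<Rightarrow> nat \<Rightarrow> 'x" and x n
    using \<open>finite F\<close> by induction auto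
  obtain s where s: "s \<in> G" "w = geometric_mix T s"
    using G \<open>w \<in> F\<close> by blast
  have "(\<Sum>t\<in>G. u (geometric_mix T t) * of_real t ^ i) = 0" for i
  proof -
    have "0 = (\<Sum>w\<in>F. fun_scale (fun_scale scaleX) (u w) w) v (position i k)"
      by (simp add: zero)
    also have "\<dots> = (\<Sum>w\<in>F. scaleX (u w) (w v (position i k)))"
      by (simp add: apply_sum fun_scale_def)
    also have "\<dots> = (\<Sum>t\<in>G. scaleX (u (geometric_mix T t) * of_real t ^ i) (T v k))"
      unfolding G(2)
      by (subst sum.reindex[OF inj_on_subset[OF inj_geometric_mix[where T=T and v=v, OF assms] subset_UNIV]])
        (simp add: geometric_mix_position)
    also have "\<dots> = scaleX (\<Sum>t\<in>G. u (geometric_mix T t) * of_real t ^ i) (T v k)"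
      by (simp add: X.scale_sum_left)
    finally show ?thesis
      using k by simp
  qed
  then show "u w = 0"
    using powers_independent[OF G(1) _ s(1), of "\<lambda>t. u (geometric_mix T t)"] s(2) by simp
qed

lemma has_dim_mixes:
  assumes T: "T \<in> Ops" "T v \<noteq> 0"
  shows "has_dim (fun_scale (fun_scale scaleX)) (mixes T) |UNIV :: real set|"
proof -
  let ?G = "geometric_mix T ` {0<..<1}"
  have "?G \<subseteq> mixes T"
    using geometric_mix_in[OF T(1)] by blast
  then obtain B where B: "?G \<subseteq> B" "B \<subseteq> mixes T" "L.independent B" "mixes T \<subseteq> L.span B"
    using L.maximal_independent_subset_extend independent_geometric_mix[where T=T and v=v, OF T(2)] by metis
  have "L.span B = mixes T"
    using B L.span_minimal[OF _ subspace_mixes] by blast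
  moreover have "|B| =o |UNIV :: real set|"
  proof (rule ordIso_iff_ordLeq[THEN iffD2], rule conjI)
    show "|B| \<le>o |UNIV :: real set|"
      using card_of_mono1[OF B(2)] card_of_mixes by (rule ordLeq_transitive)
    have "(UNIV :: real set) \<lesssim> {0<..<1::real}"
      using open_interval_eqpoll_reals[of 0 1] by (simp add: eqpoll_imp_lepoll eqpoll_sym)
    then obtain f :: "real \<Rightarrow> real" where "inj f" "range f \<subseteq> {0<..<1}"
      by (auto simp: lepoll_def)
    then have "inj (geometric_mix T \<circ> f)" "range (geometric_mix T \<circ> f) \<subseteq> B"
      using B(1) inj_geometric_mix[where T=T and v=v, OF T(2)] by (auto intro: inj_compose)
    then show "|UNIV :: real set| \<le>o |B|"
      by (subst card_of_ordLeq[symmetric]) blast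
  qed
  ultimately show ?thesis
    unfolding has_dim_def using B(3) by blast
qed

lemma has_dim_unit_iff:
  "has_dim (fun_scale (fun_scale scaleX)) W |UNIV :: unit set| \<longleftrightarrow> (\<exists>T. T \<noteq> 0 \<and> W = L.span {T})"
proof
  assume "has_dim (fun_scale (fun_scale scaleX)) W |UNIV :: unit set|"
  then obtain B where B: "L.independent B" "L.span B = W" "|B| =o |UNIV :: unit set|"
    by (auto simp: has_dim_def)
  then obtain f where "bij_betw f (UNIV :: unit set) B"
    using card_of_ordIso ordIso_symmetric by blast
  then have "B = {f ()}"
    by (auto simp: bij_betw_def UNIV_unit)
  then show "\<exists>T. T \<noteq> 0 \<and> W = L.span {T}"
    using B L.dependent_zero by auto
next
  assume "\<exists>T. T \<noteq> 0 \<and> W = L.span {T}"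
  then obtain T where T: "T \<noteq> 0" "W = L.span {T}"
    by blast
  have "bij_betw (\<lambda>_. ()) {T} UNIV"
    by (auto simp: bij_betw_def UNIV_unit)
  then have "|{T}| =o |UNIV :: unit set|"
    using card_of_ordIso by blast
  moreover have "L.independent {T}"
    using T by simp
  ultimately show "has_dim (fun_scale (fun_scale scaleX)) W |UNIV :: unit set|"
    unfolding has_dim_def using T(2) by blast
qed

lemma continuum_le_dim_Ops:
  assumes "T \<in> Ops" "T v \<noteq> 0"
  shows "\<exists>\<kappa> :: ('v \<Rightarrow> nat \<Rightarrow> 'x) rel.
    has_dim (fun_scale (fun_scale scaleX)) Ops \<kappa> \<and> |UNIV :: real set| \<le>o \<kappa>"
proof -
  obtain B where B: "L.independent B" "L.span B = mixes T" "|B| =o |UNIV :: real set|"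
    using has_dim_mixes[OF assms] by (auto simp: has_dim_def)
  have "B \<subseteq> Ops"
    using B(2) L.span_superset by (fastforce simp: mixes_def)
  then obtain B' where B': "B \<subseteq> B'" "B' \<subseteq> Ops" "L.independent B'" "Ops \<subseteq> L.span B'"
    using L.maximal_independent_subset_extend B(1) by metis
  have "L.span B' = Ops"
    using B' L.span_minimal[OF _ subspace_Ops] by blast
  then have "has_dim (fun_scale (fun_scale scaleX)) Ops |B'|"
    unfolding has_dim_def using B'(3) card_of_refl by blast
  moreover have "|UNIV :: real set| \<le>o |B'|"
    using ordIso_symmetric[OF B(3)] card_of_mono1[OF B'(1)] by (rule ordIso_ordLeq_trans)
  ultimately show ?thesis
    by blast
qed

end

section \<open>Spaceability\<close>

theorem mainTheorem3:
  fixes scaleV :: "'k::real_or_complex \<Rightarrow> 'v::banach \<Rightarrow> 'v"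
    and scaleX :: "'k \<Rightarrow> 'x::banach \<Rightarrow> 'x"
    and E :: "(nat \<Rightarrow> 'x) set" and N :: "(nat \<Rightarrow> 'x) \<Rightarrow> real"
    and I :: "('v \<Rightarrow> nat \<Rightarrow> 'x) set"
  assumes "banach_space_over scaleV"
    and "infinite_dimensional scaleV UNIV"
    and "standard_banach_sequence_space scaleX E N"
    and I_def: "I = {T \<in> continuous_operators scaleV (fun_scale scaleX) E N. inj T}"
  shows "I = {} \<or>
    spaceable (fun_scale (fun_scale scaleX)) (operator_topology scaleV (fun_scale scaleX) E N)
      |UNIV :: unit set| |UNIV :: real set| I"
proof (rule disj_imp[THEN iffD2], rule impI)
  interpret sequence_space_operators scaleV scaleX E N
    using assms by (simp add: sequence_space_operators_def)
  obtain v :: 'v where "v \<noteq> 0"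
  proof -
    have "V.span {} \<noteq> UNIV"
      using assms(2) unfolding infinite_dimensional_def by blast
    then show thesis
      using that by auto
  qed
  have nonzero: "T v \<noteq> 0" if "T \<in> I" for T
  proof
    assume "T v = 0"
    also have "0 = T 0"
      using that by (intro Ops_zero[symmetric]) (simp add: I_def)
    finally show False
      using that \<open>v \<noteq> 0\<close> injD[of T v 0] by (simp add: I_def)
  qed
  have mixes_I: "mixes T \<subseteq> I \<union> {0}" if "T \<in> I" for T
    using that mixes_injective[of T] by (auto simp: I_def mixes_def)
  have span_mixes: "L.span {T} \<subseteq> mixes T" if "T \<in> I" for T
    using that self_in_mixes subspace_mixes by (intro L.span_minimal) (auto simp: I_def)
  assume "I \<noteq> {}"
  then obtain T0 where T0: "T0 \<in> I"
    by blast
  show "spaceable (fun_scale (fun_scale scaleX)) (operator_topology scaleV (fun_scale scaleX) E N)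
      |UNIV :: unit set| |UNIV :: real set| I"
    unfolding spaceable_def lineable_def topspace_operator_topology
  proof (intro conjI allI impI)
    show "|UNIV :: unit set| <o |UNIV :: real set|"
      unfolding not_ordLeq_iff_ordLess[OF card_of_Well_order card_of_Well_order, symmetric]
      using card_of_ordLeq_infinite[of "UNIV :: real set" "UNIV :: unit set"]
      by (auto simp: infinite_UNIV_char_0)
    show "\<exists>\<kappa> :: ('v \<Rightarrow> nat \<Rightarrow> 'x) rel. has_dim (fun_scale (fun_scale scaleX)) Ops \<kappa> \<and>
        |UNIV :: real set| \<le>o \<kappa>"
      using T0 nonzero by (intro continuum_le_dim_Ops[of T0 v]) (auto simp: I_def)
    show "I \<subseteq> Ops"
      by (auto simp: I_def)
    have "L.span {T0} \<subseteq> I \<union> {0}"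
      using span_mixes[OF T0] mixes_I[OF T0] by blast
    moreover have "has_dim (fun_scale (fun_scale scaleX)) (L.span {T0}) |UNIV :: unit set|"
      using nonzero[OF T0] unfolding has_dim_unit_iff by (intro exI[of _ T0]) auto
    ultimately show "\<exists>W. W \<subseteq> I \<union> {0} \<and> has_dim (fun_scale (fun_scale scaleX)) W |UNIV :: unit set|"
      by blast
    fix W
    assume W: "W \<subseteq> I \<union> {0} \<and> has_dim (fun_scale (fun_scale scaleX)) W |UNIV :: unit set|"
    then obtain T where T: "T \<noteq> 0" "W = L.span {T}"
      unfolding has_dim_unit_iff by blast
    then have "T \<in> I"
      using W L.span_base[of T "{T}"] by blast
    then show "\<exists>W'. closedin (operator_topology scaleV (fun_scale scaleX) E N) W' \<and>
        has_dim (fun_scale (fun_scale scaleX)) W' |UNIV :: real set| \<and> W \<subseteq> W' \<and> W' \<subseteq> I \<union> {0}"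
      using closedin_mixes[of T v] has_dim_mixes[of T v] nonzero mixes_I span_mixes T(2)
      by (intro exI[of _ "mixes T"]) (simp add: I_def)
  qed
qed

end
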